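(* Consider the observable single-server queue with service rates $(\mu_n)_{n\ge 1}$, arrival rate $\lambda$ and normalized reward $\tilde R=R/C$ described in the context. 1. For any mixed strategy $\underline p\in\Pi=[0,1]^{\infty}$ the following hold: (i) $\dfrac{n+1}{M}\le W(n;\underline p)\le \dfrac{n+1}{\mu_1}$ for any $n\ge 0$; (ii) $n_b(\underline p)<\infty$. 2. For any equilibrium strategy $\underline p^e$, $\; n_0(\underline p^e)\le n_b(\underline p^e)<\infty$.
   Context: Model. Customers arrive at a single-server first-come-first-served queue according to a Poisson process with rate $\lambda>0$. When $n\ge 1$ customers are in the system, service is provided at exponential rate $\mu_n$, where $0<\mu_1\le\mu_2\le\cdots$ and $\lim_{n\to\infty}\mu_n=M<\infty$. Each arriving customer observes the number $n$ of customers present and either joins or balks. A joining customer receives a reward $R\ge0$ at service completion and pays $C>0$ per unit of time in the system, with no reneging. Let $\tilde R=R/C$. Strategies. A mixed strategy is a vector $\underline p=(p_0,p_1,\dots)\in\Pi=[0,1]^\infty$, where $p_n$ is the probability that a customer who finds $n$ customers upon arrival joins. Delay function. For $0\le n<m$, $W(n,m;\underline p)$ is the expected remaining sojourn time of a tagged customer in the system who has $n$ customers in front of her when there are $m$ customers in total (including her), when all future arrivals follow $\underline p$. That is, it is the expected time until departure of the continuous-time Markov chain started at $(n,m)$ with transitions $(i,k)\to(i,k+1)$ at rate $\lambda p_k$, $(i,k)\to(i-1,k-1)$ at rate $\mu_k$ if $i\ge1$, and $(0,k)\to$ departure at rate $\mu_k$. $W(n;\underline p)=W(n,n+1;\underline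 p)$ is the expected sojourn time of a customer who finds $n$ customers upon arrival and joins, all others following $\underline p$. Equilibrium. The expected net benefit of a customer who finds $n$ customers and follows $\underline q$ while all others follow $\underline p$ is $U_n(\underline q;\underline p)=Cq_n[\tilde R-W(n;\underline p)]$. A strategy $\underline p^e\in\Pi$ is a (symmetric Nash) equilibrium strategy if $U_n(\underline p^e;\underline p^e)\ge U_n(\underline q;\underline p^e)$ for all $\underline q\in\Pi$ and all $n\ge0$. Notation. $n_b(\underline p)=\min\{n:\tilde R-W(n;\underline p)<0\}$ and $n_0(\underline p)=\min\{n:p_n=0\}$ (with value $\infty$ if the set is empty). *)

theory Defs
  imports "HOL-Probability.Probability"
begin

section \<open>Hitting times of continuous-time Markov chains\<close>

text \<open>
  A chain on a countable state space is given by its off-diagonal transition rates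
  \<open>Q x y\<close>. It is realised through its jump chain and holding times: in the \<open>j\<close>-th visited
  state \<open>x\<close> it stays for an exponential time of rate \<open>exit_rate Q x\<close>, and then moves
  to a state drawn from \<open>jump_pmf Q x\<close>.
\<close>

definition exit_rate :: "('s \<Rightarrow> 's \<Rightarrow> real) \<Rightarrow> 's \<Rightarrow> real" where
  "exit_rate Q x = (\<Sum>\<^sub>\<infinity>y. Q x y)"

definition jump_pmf :: "('s \<Rightarrow> 's \<Rightarrow> real) \<Rightarrow> 's \<Rightarrow> 's pmf" where
  "jump_pmf Q x =
     (if exit_rate Q x = 0 then return_pmf x else embed_pmf (\<lambda>y. Q x y / exit_rate Q x))"

text \<open>
  The \<open>j\<close>-th element of the noise stream is a pair of a unit-rate exponential variable and,
  independently for every state \<open>x\<close>, the successor to be taken should the \<open>j\<close>-th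
  state be \<open>x\<close>.
\<close>

definition ctmc_noise :: "('s \<Rightarrow> 's \<Rightarrow> real) \<Rightarrow> (real \<times> ('s \<Rightarrow> 's)) stream measure" where
  "ctmc_noise Q = stream_space
     (density lborel (exponential_density 1) \<Otimes>\<^sub>M Pi\<^sub>M UNIV (\<lambda>x. measure_pmf (jump_pmf Q x)))"

primrec jump_chain :: "'s \<Rightarrow> (real \<times> ('s \<Rightarrow> 's)) stream \<Rightarrow> nat \<Rightarrow> 's" where
  "jump_chain x \<omega> 0 = x"
| "jump_chain x \<omega> (Suc j) = snd (\<omega> !! j) (jump_chain x \<omega> j)"

text \<open>The quotient is taken in \<^typ>\<open>ennreal\<close>, so a state of exit rate \<open>0\<close> is never left.\<close>

definition holding_time ::
    "('s \<Rightarrow> 's \<Rightarrow> real) \<Rightarrow> 's \<Rightarrow> (real \<times> ('s \<Rightarrow> 's)) stream \<Rightarrow> nat \<Rightarrow> ennreal" where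
  "holding_time Q x \<omega> j =
     ennreal (fst (\<omega> !! j)) / ennreal (exit_rate Q (jump_chain x \<omega> j))"

text \<open>
  The sums increase with \<open>j\<close>, so the infimum is attained at the first visit to \<open>A\<close>;
  it is \<open>\<infinity>\<close> if \<open>A\<close> is never visited.
\<close>

definition hitting_time ::
    "('s \<Rightarrow> 's \<Rightarrow> real) \<Rightarrow> 's set \<Rightarrow> 's \<Rightarrow> (real \<times> ('s \<Rightarrow> 's)) stream \<Rightarrow> ennreal" where
  "hitting_time Q A x \<omega> =
     (INF j \<in> {j. jump_chain x \<omega> j \<in> A}. \<Sum>i<j. holding_time Q x \<omega> i)"

definition expected_hitting_time ::
    "('s \<Rightarrow> 's \<Rightarrow> real) \<Rightarrow> 's set \<Rightarrow> 's \<Rightarrow> ennreal" where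
  "expected_hitting_time Q A x = (\<integral>\<^sup>+ \<omega>. hitting_time Q A x \<omega> \<partial>ctmc_noise Q)"


section \<open>The observable queue\<close>

definition strategies :: "(nat \<Rightarrow> real) set" where
  "strategies = (UNIV \<rightarrow> {0..1})"

text \<open>
  State of a tagged customer: \<open>Some (i, k)\<close> if she has \<open>i\<close> customers in front of her and
  there are \<open>k\<close> customers in the system including her, \<open>None\<close> after her departure.
  The chain starts with \<open>i < k\<close>, which every transition preserves, so \<open>\<mu> 0\<close> plays no role.
\<close>

fun tagged_rate ::
    "real \<Rightarrow> (nat \<Rightarrow> real) \<Rightarrow> (nat \<Rightarrow> real) \<Rightarrow> (nat \<times> nat) option \<Rightarrow> (nat \<times> nat) option \<Rightarrow> real" where
  "tagged_rate lam \<mu> p (Some (i, k)) (Some (i', k')) =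
     (if i' = i \<and> k' = k + 1 then lam * p k
      else if i' + 1 = i \<and> k' + 1 = k then \<mu> k
      else 0)"
| "tagged_rate lam \<mu> p (Some (i, k)) None = (if i = 0 then \<mu> k else 0)"
| "tagged_rate lam \<mu> p None y = 0"

text \<open>
  Delays are extended reals, so that no finiteness of the expectation is presupposed.
\<close>

definition remaining_delay ::
    "real \<Rightarrow> (nat \<Rightarrow> real) \<Rightarrow> (nat \<Rightarrow> real) \<Rightarrow> nat \<Rightarrow> nat \<Rightarrow> ereal" where
  "remaining_delay lam \<mu> p n m =
     enn2ereal (expected_hitting_time (tagged_rate lam \<mu> p) {None} (Some (n, m)))"

definition delay :: "real \<Rightarrow> (nat \<Rightarrow> real) \<Rightarrow> (nat \<Rightarrow> real) \<Rightarrow> nat \<Rightarrow> ereal" where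
  "delay lam \<mu> p n = remaining_delay lam \<mu> p n (n + 1)"

definition net_benefit ::
    "real \<Rightarrow> (nat \<Rightarrow> real) \<Rightarrow> real \<Rightarrow> real \<Rightarrow> nat \<Rightarrow> (nat \<Rightarrow> real) \<Rightarrow> (nat \<Rightarrow> real) \<Rightarrow> ereal" where
  "net_benefit lam \<mu> R C n q p = ereal C * ereal (q n) * (ereal (R / C) - delay lam \<mu> p n)"

definition equilibrium ::
    "real \<Rightarrow> (nat \<Rightarrow> real) \<Rightarrow> real \<Rightarrow> real \<Rightarrow> (nat \<Rightarrow> real) \<Rightarrow> bool" where
  "equilibrium lam \<mu> R C p \<longleftrightarrow> p \<in> strategies \<and>
     (\<forall>q\<in>strategies. \<forall>n. net_benefit lam \<mu> R C n p p \<ge> net_benefit lam \<mu> R C n q p)"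

text \<open>In \<^typ>\<open>enat\<close> the infimum of the empty set is \<open>\<infinity>\<close>.\<close>

definition n_b :: "real \<Rightarrow> (nat \<Rightarrow> real) \<Rightarrow> real \<Rightarrow> real \<Rightarrow> (nat \<Rightarrow> real) \<Rightarrow> enat" where
  "n_b lam \<mu> R C p = Inf (enat ` {n. ereal (R / C) - delay lam \<mu> p n < 0})"

definition n_0 :: "(nat \<Rightarrow> real) \<Rightarrow> enat" where
  "n_0 p = Inf (enat ` {n. p n = 0})"

end

theory Submission
  imports Defs
begin

text \<open>
  Expected hitting times satisfy the first-step equation and are dominated by every nonnegative
  supersolution of it, provided the expected number of jumps is finite. For the tagged customer
  the functions \<open>c * (i + 1)\<close> are supersolutions: with \<open>c = 1 / \<mu> 1\<close> for
  the time and, since all exit rates are at most \<open>lam + M\<close>, with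
  \<open>c = (lam + M) / \<mu> 1\<close> for the number of jumps. The lower bound follows by induction
  on \<open>i\<close> from the first-step equation at a near-infimum over \<open>k\<close>. It exceeds
  \<open>R / C\<close> for large \<open>n\<close>, so \<open>n_b\<close> is finite; and at a state with
  negative net benefit per joining customer, an equilibrium must balk, as balking yields \<open>0\<close>.
\<close>

section \<open>First-step analysis of hitting times\<close>

lemma jump_chain_Suc_shift:
  "jump_chain x \<omega> (Suc j) = jump_chain (snd (shd \<omega>) x) (stl \<omega>) j"
  by (induction j) simp_all

lemma holding_time_0: "holding_time Q x \<omega> 0 = ennreal (fst (shd \<omega>)) / ennreal (exit_rate Q x)"
  by (simp add: holding_time_def)

lemma holding_time_Suc_shift:
  "holding_time Q x \<omega> (Suc j) = holding_time Q (snd (shd \<omega>) x) (stl \<omega>) j"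
  by (simp add: holding_time_def jump_chain_Suc_shift del: jump_chain.simps)

lemma hitting_time_eq_0: "x \<in> A \<Longrightarrow> hitting_time Q A x \<omega> = 0"
  unfolding hitting_time_def
  by (metis (mono_tags, lifting) INF_lower bot.extremum_uniqueI bot_ennreal jump_chain.simps(1)
      lessThan_0 mem_Collect_eq sum.empty)

text \<open>The index set no longer depends on the path: times outside \<open>A\<close> contribute
  \<open>top\<close>. A countable infimum of this form gives measurability, and its index can be
  shifted.\<close>

lemma hitting_time_eq_INF:
  "hitting_time Q A x \<omega> =
     (INF j. if jump_chain x \<omega> j \<in> A then \<Sum>i<j. holding_time Q x \<omega> i else top)"
  (is "_ = (INF j. ?F j)")
proof -
  have "(INF j. ?F j) \<le> (\<Sum>i<j. holding_time Q x \<omega> i)" if "jump_chain x \<omega> j \<in> A" for j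
    using INF_lower[of j UNIV ?F] that by simp
  then show ?thesis
    unfolding hitting_time_def by (intro antisym INF_greatest) (auto intro: INF_lower)
qed

lemma hitting_time_first_step:
  assumes "x \<notin> A"
  shows "hitting_time Q A x \<omega> =
    ennreal (fst (shd \<omega>)) / ennreal (exit_rate Q x) + hitting_time Q A (snd (shd \<omega>) x) (stl \<omega>)"
proof -
  let ?t = "ennreal (fst (shd \<omega>)) / ennreal (exit_rate Q x)"
  let ?F = "\<lambda>j. if jump_chain x \<omega> j \<in> A then \<Sum>i<j. holding_time Q x \<omega> i else top"
  let ?G = "\<lambda>j. if jump_chain (snd (shd \<omega>) x) (stl \<omega>) j \<in> A
    then \<Sum>i<j. holding_time Q (snd (shd \<omega>) x) (stl \<omega>) i else top"
  have F0: "?F 0 = top" using assms by simp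
  have FS: "?F (Suc j) = ?t + ?G j" for j
    by (simp add: sum.lessThan_Suc_shift holding_time_0 holding_time_Suc_shift jump_chain_Suc_shift
        del: jump_chain.simps sum.lessThan_Suc)
  have "(INF j. ?F j) = (INF j. ?F (Suc j))"
  proof (intro antisym INF_greatest)
    fix j show "(INF j. ?F (Suc j)) \<le> ?F j"
    proof (cases j)
      case (Suc n)
      show ?thesis unfolding Suc by (rule INF_lower[of n UNIV "\<lambda>j. ?F (Suc j)"]) simp
    qed (simp only: F0 top_greatest)
  qed (rule INF_lower, simp)
  then show ?thesis
    unfolding hitting_time_eq_INF FS INF_ennreal_const_add .
qed

section \<open>Independence of the first step from the rest of the noise\<close>

context
  fixes Q :: "'s::countable \<Rightarrow> 's \<Rightarrow> real"
begin

abbreviation step_noise :: "(real \<times> ('s \<Rightarrow> 's)) measure" where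
  "step_noise \<equiv> density lborel (exponential_density 1) \<Otimes>\<^sub>M Pi\<^sub>M UNIV (\<lambda>x. measure_pmf (jump_pmf Q x))"

lemma prob_space_step_noise: "prob_space step_noise"
  by (intro prob_space_pair prob_space_exponential_density prob_space_PiM)
     (auto simp: measure_pmf.prob_space_axioms)

lemma prob_space_ctmc_noise: "prob_space (ctmc_noise Q)"
  unfolding ctmc_noise_def by (rule prob_space.prob_space_stream_space[OF prob_space_step_noise])

lemma measurable_noise_time [measurable]: "fst \<in> borel_measurable step_noise"
  by (rule measurable_compose[OF measurable_fst]) simp

lemma measurable_noise_succ [measurable]: "(\<lambda>e. snd e x) \<in> measurable step_noise (count_space UNIV)"
  by (rule measurable_compose[OF measurable_snd])
     (rule measurable_compose[OF measurable_component_singleton[of x]], simp_all)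

lemma measurable_shift_noise [measurable]:
  "(\<lambda>\<omega>. fst (shd \<omega>)) \<in> borel_measurable (ctmc_noise Q)"
  "(\<lambda>\<omega>. snd (shd \<omega>) x) \<in> measurable (ctmc_noise Q) (count_space UNIV)"
  "stl \<in> measurable (ctmc_noise Q) (ctmc_noise Q)"
  unfolding ctmc_noise_def
  by (auto intro: measurable_compose[OF measurable_shd measurable_noise_time]
      measurable_compose[OF measurable_shd measurable_noise_succ])

text \<open>The successor ranges over a countable type, so the map is glued from countably many
  measurable functions \<open>G y\<close> composed with \<open>stl\<close>.\<close>

lemma measurable_after_first_step [measurable]:
  assumes G: "\<And>y. G y \<in> borel_measurable (ctmc_noise Q)"
  shows "(\<lambda>\<omega>. G (snd (shd \<omega>) x) (stl \<omega>)) \<in> borel_measurable (ctmc_noise Q)"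
  by (rule measurable_compose_countable[OF measurable_compose[OF measurable_shift_noise(3) G]
        measurable_shift_noise(2)])

text \<open>Markov property at the first jump. The head of the stream is independent of its tail,
  its two components are independent of each other, and coordinate \<open>x\<close> of the successor
  map has law \<open>jump_pmf Q x\<close>.\<close>

lemma nn_integral_ctmc_noise_first_step:
  assumes c [measurable]: "c \<in> borel_measurable borel"
    and G: "\<And>y. G y \<in> borel_measurable (ctmc_noise Q)"
  shows "(\<integral>\<^sup>+\<omega>. c (fst (shd \<omega>)) + G (snd (shd \<omega>) x) (stl \<omega>) \<partial>ctmc_noise Q) =
    (\<integral>\<^sup>+t. c t \<partial>density lborel (exponential_density 1)) +
    (\<integral>\<^sup>+y. (\<integral>\<^sup>+\<omega>. G y \<omega> \<partial>ctmc_noise Q) \<partial>measure_pmf (jump_pmf Q x))"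
proof -
  let ?E = "density lborel (exponential_density 1)"
  let ?P = "Pi\<^sub>M UNIV (\<lambda>x. measure_pmf (jump_pmf Q x))"
  let ?g = "\<lambda>y. \<integral>\<^sup>+\<omega>. G y \<omega> \<partial>ctmc_noise Q"
  interpret E: prob_space ?E by (rule prob_space_exponential_density) simp
  interpret P: prob_space ?P by (intro prob_space_PiM measure_pmf.prob_space_axioms)
  interpret N: prob_space step_noise by (rule prob_space_step_noise)
  interpret S: prob_space "ctmc_noise Q" by (rule prob_space_ctmc_noise)
  note [measurable] = measurable_after_first_step[OF G] G
  have succ [measurable]: "(\<lambda>f. f x) \<in> measurable ?P (count_space UNIV)"
    by (rule measurable_compose[OF measurable_component_singleton[of x]]) simp_all
  have "(\<lambda>\<omega>. c (fst (shd \<omega>)) + G (snd (shd \<omega>) x) (stl \<omega>)) \<in> borel_measurable (ctmc_noise Q)"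
    by measurable
  then have "(\<integral>\<^sup>+\<omega>. c (fst (shd \<omega>)) + G (snd (shd \<omega>) x) (stl \<omega>) \<partial>ctmc_noise Q) =
      (\<integral>\<^sup>+e. (\<integral>\<^sup>+\<omega>. c (fst e) + G (snd e x) \<omega> \<partial>ctmc_noise Q) \<partial>step_noise)"
    unfolding ctmc_noise_def by (subst N.nn_integral_stream_space) simp_all
  also have "\<dots> = (\<integral>\<^sup>+e. c (fst e) + ?g (snd e x) \<partial>step_noise)"
    by (intro nn_integral_cong) (simp add: nn_integral_add S.emeasure_space_1)
  also have "\<dots> = (\<integral>\<^sup>+e. c (fst e) \<partial>step_noise) + (\<integral>\<^sup>+e. ?g (snd e x) \<partial>step_noise)"
    by (intro nn_integral_add measurable_compose[OF measurable_noise_time c]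
        measurable_compose[OF measurable_noise_succ]) simp
  also have "(\<integral>\<^sup>+e. c (fst e) \<partial>step_noise) = (\<integral>\<^sup>+t. c t \<partial>?E)"
    using P.nn_integral_fst[OF measurable_compose[OF measurable_noise_time c]]
    by (simp add: P.emeasure_space_1)
  also have "(\<integral>\<^sup>+e. ?g (snd e x) \<partial>step_noise) = (\<integral>\<^sup>+f. ?g (f x) \<partial>?P)"
    using P.nn_integral_fst[OF measurable_compose[OF measurable_noise_succ[of x], of ?g borel]]
    by (simp add: E.emeasure_space_1[simplified])
  also have "\<dots> = (\<integral>\<^sup>+y. ?g y \<partial>distr ?P (measure_pmf (jump_pmf Q x)) (\<lambda>f. f x))"
    by (subst nn_integral_distr) simp_all
  also have "distr ?P (measure_pmf (jump_pmf Q x)) (\<lambda>f. f x) = measure_pmf (jump_pmf Q x)"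
    by (rule distr_PiM_component) (simp_all add: measure_pmf.prob_space_axioms)
  finally show ?thesis .
qed

text \<open>A unit exponential variable has mean 1. For \<open>q = 0\<close> both sides are
  \<open>top\<close>, in agreement with a state that is never left.\<close>

lemma nn_integral_holding_time:
  "(\<integral>\<^sup>+t. ennreal t / ennreal q \<partial>density lborel (exponential_density 1)) = 1 / ennreal q"
proof -
  have "(\<integral>\<^sup>+t. ennreal t \<partial>density lborel (exponential_density 1)) =
      (\<integral>\<^sup>+t. ennreal (exponential_density 1 t * t ^ 1) \<partial>lborel)"
    by (subst nn_integral_density) (auto intro!: nn_integral_cong simp: ennreal_mult')
  also have "\<dots> = 1"
    by (subst nn_integral_erlang_ith_moment) simp_all
  finally show ?thesis
    by (simp add: nn_integral_divide)
qed

lemma measurable_jump_chain [measurable]: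
  "(\<lambda>\<omega>. jump_chain x \<omega> j) \<in> measurable (ctmc_noise Q) (count_space UNIV)"
proof (induction j)
  case (Suc j)
  have "(\<lambda>\<omega>. snd (\<omega> !! j) y) \<in> measurable (ctmc_noise Q) (count_space UNIV)" for y
    unfolding ctmc_noise_def by (rule measurable_compose[OF measurable_snth measurable_noise_succ])
  from measurable_compose_countable[OF this Suc] show ?case by simp
qed simp

lemma measurable_holding_time [measurable]:
  "(\<lambda>\<omega>. holding_time Q x \<omega> j) \<in> borel_measurable (ctmc_noise Q)"
proof -
  have [measurable]: "(\<lambda>\<omega>. fst (\<omega> !! j)) \<in> borel_measurable (ctmc_noise Q)"
    unfolding ctmc_noise_def by (rule measurable_compose[OF measurable_snth measurable_noise_time])
  have "(\<lambda>\<omega>. ennreal (exit_rate Q (jump_chain x \<omega> j))) \<in> borel_measurable (ctmc_noise Q)"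
    by (rule measurable_compose[OF measurable_jump_chain]) simp
  then show ?thesis
    unfolding holding_time_def by measurable
qed

lemma measurable_hitting_time [measurable]:
  "hitting_time Q A x \<in> borel_measurable (ctmc_noise Q)"
proof -
  have "Measurable.pred (ctmc_noise Q) (\<lambda>\<omega>. jump_chain x \<omega> j \<in> A)" for j
    by (rule measurable_compose[OF measurable_jump_chain]) simp
  then show ?thesis
    unfolding hitting_time_eq_INF[abs_def] by measurable
qed

lemma expected_hitting_time_first_step:
  assumes "x \<notin> A"
  shows "expected_hitting_time Q A x = 1 / ennreal (exit_rate Q x) +
    (\<integral>\<^sup>+y. expected_hitting_time Q A y \<partial>measure_pmf (jump_pmf Q x))"
  unfolding expected_hitting_time_def hitting_time_first_step[OF assms]
  by (subst nn_integral_ctmc_noise_first_step[of "\<lambda>t. ennreal t / ennreal (exit_rate Q x)"])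
     (simp_all add: nn_integral_holding_time)

end

section \<open>Upper bounds by supersolutions\<close>

text \<open>Cost accumulated over at most the given number of jumps and stopped on entering
  \<open>A\<close>. The cost \<open>c\<close> depends on the state and on the raw exponential
  variable, so that elapsed time (\<open>t\<close> divided by the exit rate) and the number of jumps
  (constant 1) are both instances.\<close>

primrec path_cost ::
    "('s \<Rightarrow> real \<Rightarrow> ennreal) \<Rightarrow> 's set \<Rightarrow> nat \<Rightarrow> 's \<Rightarrow> (real \<times> ('s \<Rightarrow> 's)) stream \<Rightarrow> ennreal" where
  "path_cost c A 0 x \<omega> = 0"
| "path_cost c A (Suc n) x \<omega> =
     (if x \<in> A then 0 else c x (fst (shd \<omega>)) + path_cost c A n (snd (shd \<omega>) x) (stl \<omega>))"

lemma path_cost_mono: "path_cost c A n x \<omega> \<le> path_cost c A (Suc n) x \<omega>"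
proof (induction n arbitrary: x \<omega>)
  case (Suc n)
  show ?case
    by (subst (1 2) path_cost.simps(2)) (use Suc in \<open>auto intro: add_left_mono\<close>)
qed simp

lemma path_cost_one_never_hit:
  "(\<And>j. jump_chain x \<omega> j \<notin> A) \<Longrightarrow> path_cost (\<lambda>_ _. 1) A n x \<omega> = of_nat n"
proof (induction n arbitrary: x \<omega>)
  case (Suc n)
  have "path_cost (\<lambda>_ _. 1) A n (snd (shd \<omega>) x) (stl \<omega>) = of_nat n"
    using Suc.prems[of "Suc _"] by (intro Suc.IH) (simp only: jump_chain_Suc_shift not_False_eq_True)
  moreover have "x \<notin> A" using Suc.prems[of 0] by simp
  ultimately show ?case by simp
qed simp

text \<open>Truncation after \<open>j\<close> steps loses nothing on such a path: costs accrue only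
  until the first visit to \<open>A\<close>, which happens no later than index
  \<open>j\<close>.\<close>

lemma hitting_time_le_path_cost:
  "jump_chain x \<omega> j \<in> A \<Longrightarrow>
    hitting_time Q A x \<omega> \<le> path_cost (\<lambda>x t. ennreal t / ennreal (exit_rate Q x)) A j x \<omega>"
proof (induction j arbitrary: x \<omega>)
  case (Suc j)
  then show ?case
    by (cases "x \<in> A")
       (auto simp: hitting_time_eq_0 hitting_time_first_step jump_chain_Suc_shift
         simp del: jump_chain.simps intro: add_left_mono)
qed (simp add: hitting_time_eq_0)

context
  fixes Q :: "'s::countable \<Rightarrow> 's \<Rightarrow> real"
begin

lemma measurable_path_cost [measurable]:
  assumes [measurable]: "\<And>x. c x \<in> borel_measurable borel"
  shows "path_cost c A n x \<in> borel_measurable (ctmc_noise Q)"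
proof (induction n arbitrary: x)
  case (Suc n)
  note [measurable] = measurable_after_first_step[OF Suc] measurable_shift_noise(1)[of Q]
  show ?case
    unfolding path_cost.simps[abs_def] by measurable
qed (simp add: path_cost.simps(1)[abs_def])

text \<open>Induction on the number of steps. Conditioning on the first jump and applying the
  induction hypothesis at the successor leaves exactly the left side of the supersolution
  inequality.\<close>

lemma nn_integral_path_cost_le:
  assumes c: "\<And>x. c x \<in> borel_measurable borel"
    and V: "\<And>x. x \<notin> A \<Longrightarrow> (\<integral>\<^sup>+t. c x t \<partial>density lborel (exponential_density 1)) +
      (\<integral>\<^sup>+y. V y \<partial>measure_pmf (jump_pmf Q x)) \<le> V x"
  shows "(\<integral>\<^sup>+\<omega>. path_cost c A n x \<omega> \<partial>ctmc_noise Q) \<le> V x"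
proof (induction n arbitrary: x)
  case (Suc n)
  show ?case
  proof (cases "x \<in> A")
    case False
    have "(\<integral>\<^sup>+\<omega>. path_cost c A (Suc n) x \<omega> \<partial>ctmc_noise Q) =
        (\<integral>\<^sup>+t. c x t \<partial>density lborel (exponential_density 1)) +
        (\<integral>\<^sup>+y. (\<integral>\<^sup>+\<omega>. path_cost c A n y \<omega> \<partial>ctmc_noise Q) \<partial>measure_pmf (jump_pmf Q x))"
      using False nn_integral_ctmc_noise_first_step[where c = "c x" and G = "path_cost c A n",
          OF c measurable_path_cost[OF c]]
      by simp
    also have "\<dots> \<le> (\<integral>\<^sup>+t. c x t \<partial>density lborel (exponential_density 1)) +
        (\<integral>\<^sup>+y. V y \<partial>measure_pmf (jump_pmf Q x))"
      by (intro add_left_mono nn_integral_mono Suc)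
    also have "\<dots> \<le> V x" by (rule V[OF False])
    finally show ?thesis .
  qed (simp add: path_cost.simps(2)[abs_def])
qed (simp add: path_cost.simps(1)[abs_def])

lemma nn_integral_SUP_path_cost_le:
  assumes c: "\<And>x. c x \<in> borel_measurable borel"
    and V: "\<And>x. x \<notin> A \<Longrightarrow> (\<integral>\<^sup>+t. c x t \<partial>density lborel (exponential_density 1)) +
      (\<integral>\<^sup>+y. V y \<partial>measure_pmf (jump_pmf Q x)) \<le> V x"
  shows "(\<integral>\<^sup>+\<omega>. (SUP n. path_cost c A n x \<omega>) \<partial>ctmc_noise Q) \<le> V x"
proof -
  have "(\<integral>\<^sup>+\<omega>. (SUP n. path_cost c A n x \<omega>) \<partial>ctmc_noise Q) =
      (SUP n. \<integral>\<^sup>+\<omega>. path_cost c A n x \<omega> \<partial>ctmc_noise Q)"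
    by (intro nn_integral_monotone_convergence_SUP measurable_path_cost c)
       (auto simp: incseq_Suc_iff le_fun_def path_cost_mono simp del: path_cost.simps)
  also have "\<dots> \<le> V x"
    by (intro SUP_least nn_integral_path_cost_le c V)
  finally show ?thesis .
qed

text \<open>
  A supersolution for the elapsed time alone does not suffice: the hitting time is infinite on
  paths that avoid \<open>A\<close>, even if they make infinitely many jumps in finite time. The
  supersolution \<open>N\<close> for the number of jumps excludes such paths almost surely.
\<close>

lemma expected_hitting_time_le:
  assumes V: "\<And>x. x \<notin> A \<Longrightarrow>
      1 / ennreal (exit_rate Q x) + (\<integral>\<^sup>+y. V y \<partial>measure_pmf (jump_pmf Q x)) \<le> V x"
    and N: "\<And>x. x \<notin> A \<Longrightarrow> 1 + (\<integral>\<^sup>+y. N y \<partial>measure_pmf (jump_pmf Q x)) \<le> N x"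
    and fin: "N x < top"
  shows "expected_hitting_time Q A x \<le> V x"
proof -
  let ?c = "\<lambda>x t. ennreal t / ennreal (exit_rate Q x)"
  have E1: "(\<integral>\<^sup>+t. 1 \<partial>density lborel (exponential_density 1)) = (1 :: ennreal)"
    using prob_space.emeasure_space_1[OF prob_space_exponential_density[of 1]] by simp
  have "(\<integral>\<^sup>+\<omega>. (SUP n. path_cost (\<lambda>_ _. 1) A n x \<omega>) \<partial>ctmc_noise Q) \<le> N x"
    by (rule nn_integral_SUP_path_cost_le) (simp_all add: E1 N del: nn_integral_const)
  then have "AE \<omega> in ctmc_noise Q. (SUP n. path_cost (\<lambda>_ _. 1) A n x \<omega>) \<noteq> \<infinity>"
    using fin by (intro nn_integral_PInf_AE) (auto simp: top_unique)
  then have "AE \<omega> in ctmc_noise Q. hitting_time Q A x \<omega> \<le> (SUP n. path_cost ?c A n x \<omega>)"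
  proof (eventually_elim)
    case (elim \<omega>)
    have "\<exists>j. jump_chain x \<omega> j \<in> A"
    proof (rule ccontr)
      assume "\<nexists>j. jump_chain x \<omega> j \<in> A"
      then have "path_cost (\<lambda>_ _. 1) A n x \<omega> = of_nat n" for n
        by (intro path_cost_one_never_hit) blast
      with elim show False by (simp add: ennreal_SUP_of_nat_eq_top)
    qed
    then obtain j where "jump_chain x \<omega> j \<in> A" ..
    from hitting_time_le_path_cost[OF this] show ?case
      by (rule order_trans) (rule SUP_upper, simp)
  qed
  then have "expected_hitting_time Q A x \<le> (\<integral>\<^sup>+\<omega>. (SUP n. path_cost ?c A n x \<omega>) \<partial>ctmc_noise Q)"
    unfolding expected_hitting_time_def by (rule nn_integral_mono_AE)
  also have "\<dots> \<le> V x"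
    by (rule nn_integral_SUP_path_cost_le) (simp_all add: nn_integral_holding_time V)
  finally show ?thesis .
qed

section \<open>Exit rates and jump laws with finitely many successors\<close>

lemma exit_rate_eq_sum:
  assumes "finite S" and "\<And>y. y \<notin> S \<Longrightarrow> Q x y = 0"
  shows "exit_rate Q x = (\<Sum>y\<in>S. Q x y)"
proof -
  have "exit_rate Q x = infsum (Q x) S"
    unfolding exit_rate_def by (rule infsum_cong_neutral) (use assms in auto)
  then show ?thesis using assms by simp
qed

lemma nn_integral_jump_pmf:
  assumes S: "finite S" "\<And>y. y \<notin> S \<Longrightarrow> Q x y = 0"
    and nonneg: "\<And>y. 0 \<le> Q x y" and pos: "0 < exit_rate Q x"
  shows "(\<integral>\<^sup>+y. f y \<partial>measure_pmf (jump_pmf Q x)) =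
    (\<Sum>y\<in>S. ennreal (Q x y / exit_rate Q x) * f y)"
proof -
  \<comment> \<open>The normalized rates have total mass 1; only then does \<open>embed_pmf\<close>
    return them as point masses.\<close>
  have "(\<integral>\<^sup>+y. ennreal (Q x y / exit_rate Q x) \<partial>count_space UNIV) =
      (\<Sum>y\<in>S. ennreal (Q x y / exit_rate Q x))"
    by (rule nn_integral_count_space'[OF S(1)]) (auto simp: S(2))
  also have "\<dots> = ennreal ((\<Sum>y\<in>S. Q x y) / exit_rate Q x)"
    using nonneg pos by (subst sum_ennreal) (auto simp: sum_divide_distrib)
  also have "\<dots> = 1"
    using pos by (simp add: exit_rate_eq_sum[OF S])
  finally have pmf: "pmf (jump_pmf Q x) y = Q x y / exit_rate Q x" for y
    using nonneg pos by (simp add: jump_pmf_def pmf_embed_pmf)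
  show ?thesis
    by (subst nn_integral_measure_pmf_support[OF S(1)])
       (auto simp: set_pmf_iff pmf S(2) mult.commute)
qed

end

section \<open>The tagged customer\<close>

text \<open>A single name for the target of a service completion, including departure, so that every
  state with \<open>i < k\<close> has the same two candidate successors.\<close>

definition served :: "nat \<Rightarrow> nat \<Rightarrow> (nat \<times> nat) option" where
  "served i k = (if i = 0 then None else Some (i - 1, k - 1))"

text \<open>
  The value \<open>top\<close> on the unreachable states with \<open>i \<ge> k\<close> makes the
  supersolution inequality trivial there.
\<close>

definition linear_bound :: "real \<Rightarrow> (nat \<times> nat) option \<Rightarrow> ennreal" where
  "linear_bound c s = (case s of None \<Rightarrow> 0
     | Some (i, k) \<Rightarrow> if i < k then ennreal (c * (real i + 1)) else top)"

text \<open>Monotone convergence of the service rates enters the estimates through the two bounds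
  \<open>mu_lower\<close> and \<open>mu_upper\<close>; here \<open>M\<close> stands for any upper
  bound.\<close>

locale queue =
  fixes lam M :: real and \<mu> p :: "nat \<Rightarrow> real"
  assumes lam_pos: "0 < lam"
    and mu1_pos: "0 < \<mu> 1"
    and mu_lower: "\<And>n. 1 \<le> n \<Longrightarrow> \<mu> 1 \<le> \<mu> n"
    and mu_upper: "\<And>n. 1 \<le> n \<Longrightarrow> \<mu> n \<le> M"
    and p_bounds: "\<And>n. 0 \<le> p n" "\<And>n. p n \<le> 1"
begin

abbreviation "rates \<equiv> tagged_rate lam \<mu> p"
abbreviation "h i k \<equiv> expected_hitting_time rates {None} (Some (i, k))"

lemma M_pos: "0 < M"
  using mu1_pos mu_upper[of 1] by simp

lemma mu_pos: "i < k \<Longrightarrow> 0 < \<mu> k"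
  using mu1_pos mu_lower[of k] by simp

lemma total_rate_pos: "i < k \<Longrightarrow> 0 < lam * p k + \<mu> k"
  using mu_pos lam_pos p_bounds(1)[of k] by (simp add: add_nonneg_pos)

lemma total_rate_le: "i < k \<Longrightarrow> lam * p k + \<mu> k \<le> lam + M"
  using mu_upper[of k] lam_pos p_bounds(2)[of k] mult_left_le[of "p k" lam] by linarith

lemma rates_values:
  assumes "i < k"
  shows "rates (Some (i, k)) (Some (i, Suc k)) = lam * p k"
    "rates (Some (i, k)) (served i k) = \<mu> k"
    "y \<notin> {Some (i, Suc k), served i k} \<Longrightarrow> rates (Some (i, k)) y = 0"
proof -
  show "rates (Some (i, k)) (Some (i, Suc k)) = lam * p k" by simp
  show "rates (Some (i, k)) (served i k) = \<mu> k" using assms by (auto simp: served_def)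
  show "rates (Some (i, k)) y = 0" if "y \<notin> {Some (i, Suc k), served i k}"
    using that by (cases y) (auto simp: served_def split: if_splits)
qed

text \<open>Guarantees that sums over the two-successor set really have two terms.\<close>

lemma served_neq: "served i k \<noteq> Some (i, Suc k)"
  by (auto simp: served_def)

lemma rates_nonneg: "i < k \<Longrightarrow> 0 \<le> rates (Some (i, k)) y"
  using mu_pos[of i k] lam_pos p_bounds(1)[of k] by (cases y) auto

lemma exit_rate_rates: "i < k \<Longrightarrow> exit_rate rates (Some (i, k)) = lam * p k + \<mu> k"
  using served_neq[of i k]
  by (subst exit_rate_eq_sum[where S = "{Some (i, Suc k), served i k}"])
     (auto simp: rates_values simp del: tagged_rate.simps)

lemma nn_integral_jump_rates:
  assumes "i < k"
  shows "(\<integral>\<^sup>+y. f y \<partial>measure_pmf (jump_pmf rates (Some (i, k)))) =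
    ennreal (lam * p k / (lam * p k + \<mu> k)) * f (Some (i, Suc k)) +
    ennreal (\<mu> k / (lam * p k + \<mu> k)) * f (served i k)"
  using served_neq[of i k] assms total_rate_pos[OF assms]
  by (subst nn_integral_jump_pmf[where S = "{Some (i, Suc k), served i k}"])
     (auto simp: rates_values rates_nonneg exit_rate_rates simp del: tagged_rate.simps)

text \<open>A drift computation: an arrival leaves the bound unchanged, and a service completion, of
  probability \<open>\<mu> k / (lam * p k + \<mu> k)\<close>, lowers it by \<open>c\<close>. The
  expected decrease therefore pays for a cost \<open>b\<close> per jump exactly under hypothesis
  \<open>b\<close>.\<close>

lemma linear_bound_supersolution:
  assumes "i < k" and "0 \<le> b" "0 \<le> c" and b: "b * (lam * p k + \<mu> k) \<le> c * \<mu> k"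
  shows "ennreal b + (\<integral>\<^sup>+y. linear_bound c y \<partial>measure_pmf (jump_pmf rates (Some (i, k))))
    \<le> linear_bound c (Some (i, k))"
proof -
  let ?q = "lam * p k + \<mu> k"
  note q = total_rate_pos[OF \<open>i < k\<close>] and m = mu_pos[OF \<open>i < k\<close>]
  have a: "0 \<le> lam * p k" using lam_pos p_bounds(1)[of k] by simp
  have up: "linear_bound c (Some (i, Suc k)) = ennreal (c * (real i + 1))"
    using \<open>i < k\<close> by (simp add: linear_bound_def)
  have served: "linear_bound c (served i k) = ennreal (c * real i)"
    using \<open>i < k\<close> by (auto simp: linear_bound_def served_def of_nat_diff)
  have "ennreal b + (\<integral>\<^sup>+y. linear_bound c y \<partial>measure_pmf (jump_pmf rates (Some (i, k)))) =
      ennreal (b + lam * p k / ?q * (c * (real i + 1)) + \<mu> k / ?q * (c * real i))"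
    using a m q assms(1-3)
    by (simp add: nn_integral_jump_rates served up ennreal_mult ennreal_plus
        add.assoc del: times_divide_eq_left times_divide_eq_right)
  also have "\<dots> \<le> ennreal (c * (real i + 1))"
  proof (rule ennreal_leI)
    have "b + lam * p k / ?q * (c * (real i + 1)) + \<mu> k / ?q * (c * real i) =
        (b * ?q + lam * p k * (c * (real i + 1)) + \<mu> k * (c * real i)) / ?q"
      using q by (simp add: add_divide_distrib)
    also have "\<dots> \<le> (c * \<mu> k + lam * p k * (c * (real i + 1)) + \<mu> k * (c * real i)) / ?q"
      using q b by (intro divide_right_mono) auto
    also have "\<dots> = c * (real i + 1) * ?q / ?q"
      by (simp add: algebra_simps)
    also have "\<dots> = c * (real i + 1)" using q by simp
    finally show "b + lam * p k / ?q * (c * (real i + 1)) + \<mu> k / ?q * (c * real i)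
      \<le> c * (real i + 1)" .
  qed
  also have "\<dots> = linear_bound c (Some (i, k))"
    using \<open>i < k\<close> by (simp add: linear_bound_def)
  finally show ?thesis .
qed

lemma h_le:
  assumes "i < k"
  shows "h i k \<le> ennreal ((real i + 1) / \<mu> 1)"
proof -
  have "h i k \<le> linear_bound (1 / \<mu> 1) (Some (i, k))"
  proof (rule expected_hitting_time_le[where N = "linear_bound ((lam + M) / \<mu> 1)"])
    fix x :: "(nat \<times> nat) option" assume "x \<notin> {None}"
    then obtain i k where x: "x = Some (i, k)" by auto
    show "1 / ennreal (exit_rate rates x) +
        (\<integral>\<^sup>+y. linear_bound (1 / \<mu> 1) y \<partial>measure_pmf (jump_pmf rates x)) \<le> linear_bound (1 / \<mu> 1) x"
    proof (cases "i < k")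
      case True
      \<comment> \<open>With the mean holding time as cost per jump, the drift condition reduces to
        \<open>\<mu> 1 \<le> \<mu> k\<close>.\<close>
      have "1 / ennreal (exit_rate rates x) = ennreal (1 / (lam * p k + \<mu> k))"
        using total_rate_pos[OF True] True
        by (simp add: x exit_rate_rates divide_ennreal ennreal_1[symmetric] del: ennreal_1)
      with linear_bound_supersolution[OF True, of "1 / (lam * p k + \<mu> k)" "1 / \<mu> 1"]
      show ?thesis
        using total_rate_pos[OF True] mu1_pos mu_lower[of k] True by (simp add: x field_simps)
    qed (simp add: x linear_bound_def)
    show "1 + (\<integral>\<^sup>+y. linear_bound ((lam + M) / \<mu> 1) y \<partial>measure_pmf (jump_pmf rates x))
        \<le> linear_bound ((lam + M) / \<mu> 1) x"
    proof (cases "i < k")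
      case True
      have "lam * p k + \<mu> k \<le> (lam + M) / \<mu> 1 * \<mu> 1"
        using total_rate_le[OF True] mu1_pos by simp
      also have "\<dots> \<le> (lam + M) / \<mu> 1 * \<mu> k"
        using True mu1_pos mu_lower[of k] lam_pos M_pos by (intro mult_left_mono) auto
      finally show ?thesis
        using linear_bound_supersolution[OF True, of 1 "(lam + M) / \<mu> 1"] lam_pos M_pos mu1_pos
        by (simp add: x)
    qed (simp add: x linear_bound_def)
  qed (use assms in \<open>simp add: linear_bound_def\<close>)
  also have "\<dots> = ennreal ((real i + 1) / \<mu> 1)"
    using assms by (simp add: linear_bound_def)
  finally show ?thesis .
qed

section \<open>Lower bound on the remaining delay\<close>

definition hr :: "nat \<Rightarrow> nat \<Rightarrow> real" where
  "hr i k = enn2real (h i k)"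

text \<open>Finiteness comes from the upper bound \<open>h_le\<close>. It allows real arithmetic, in
  which terms of the first-step equation can be subtracted.\<close>

lemma h_eq_hr: "i < k \<Longrightarrow> h i k = ennreal (hr i k)"
  unfolding hr_def
  by (rule ennreal_enn2real[symmetric], rule le_less_trans[OF h_le]) simp_all

text \<open>The first-step equation multiplied by the total rate. The value 0 for
  \<open>i = 0\<close> is the delay remaining after departure.\<close>

lemma hr_first_step:
  assumes "i < k"
  shows "(lam * p k + \<mu> k) * hr i k =
    1 + lam * p k * hr i (Suc k) + \<mu> k * (if i = 0 then 0 else hr (i - 1) (k - 1))"
proof -
  let ?q = "lam * p k + \<mu> k"
  let ?d = "if i = 0 then 0 else hr (i - 1) (k - 1)"
  note q = total_rate_pos[OF assms] and m = mu_pos[OF assms]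
  have a: "0 \<le> lam * p k" using lam_pos p_bounds(1)[of k] by simp
  have nn: "0 \<le> hr i k" for i k by (simp add: hr_def)
  have d: "expected_hitting_time rates {None} (served i k) = ennreal ?d"
  proof (cases "i = 0")
    case True
    then show ?thesis by (simp add: served_def expected_hitting_time_def hitting_time_eq_0)
  next
    case False
    then have "i - 1 < k - 1" using assms by simp
    from h_eq_hr[OF this] show ?thesis using False by (simp only: served_def if_False)
  qed
  have inv: "1 / ennreal ?q = ennreal (1 / ?q)"
    using q by (simp add: divide_ennreal ennreal_1[symmetric] del: ennreal_1)
  have "ennreal (hr i k) = 1 / ennreal ?q + (ennreal (lam * p k / ?q) * h i (Suc k) +
      ennreal (\<mu> k / ?q) * expected_hitting_time rates {None} (served i k))"
    unfolding h_eq_hr[OF assms, symmetric]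
    using expected_hitting_time_first_step[of "Some (i, k)" "{None}" rates]
    unfolding nn_integral_jump_rates[OF assms] exit_rate_rates[OF assms] by blast
  also have "\<dots> = ennreal (1 / ?q + (lam * p k / ?q * hr i (Suc k) + \<mu> k / ?q * ?d))"
    unfolding d inv using q m a nn assms h_eq_hr[of i "Suc k"]
    by (simp add: ennreal_mult ennreal_plus del: times_divide_eq_left times_divide_eq_right)
  finally have "hr i k = 1 / ?q + (lam * p k / ?q * hr i (Suc k) + \<mu> k / ?q * ?d)"
    by (subst (asm) ennreal_inj) (use q m a nn in \<open>simp_all del: times_divide_eq_left\<close>)
  then have "?q * hr i k = ?q * (1 / ?q + (lam * p k / ?q * hr i (Suc k) + \<mu> k / ?q * ?d))"
    by (rule arg_cong)
  also have "\<dots> = 1 + lam * p k * hr i (Suc k) + \<mu> k * ?d"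
    using q by (simp add: distrib_left)
  finally show ?thesis .
qed

text \<open>
  By the first-step equation, an infimum \<open>I\<close> of \<open>hr i\<close> below the bound
  \<open>B\<close> could be raised by a positive amount that does not depend on \<open>k\<close>.
\<close>

lemma hr_ge_step:
  assumes d: "\<And>k. i < k \<Longrightarrow> real i / M \<le> (if i = 0 then 0 else hr (i - 1) (k - 1))"
    and k: "i < k"
  shows "(real i + 1) / M \<le> hr i k"
proof -
  have nn: "0 \<le> hr i k" for i k by (simp add: hr_def)
  define B where "B = (real i + 1) / M"
  define I where "I = (INF k\<in>{i<..}. hr i k)"
  have bdd: "bdd_below (hr i ` {i<..})" using nn by (intro bdd_belowI2[of _ 0])
  have I: "I \<le> hr i k" if "i < k" for k
    unfolding I_def by (rule cINF_lower[OF bdd]) (use that in simp)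
  have "B \<le> I"
  proof (rule ccontr)
    assume "\<not> B \<le> I"
    then have BI: "0 < B - I" by simp
    \<comment> \<open>The factor \<open>\<mu> 1 / (lam + M)\<close> bounds from below the
      probability that the next event is a service, uniformly in \<open>k\<close>.\<close>
    define e where "e = \<mu> 1 / (lam + M) * (B - I)"
    have e: "0 < e" unfolding e_def using BI mu1_pos lam_pos M_pos by simp
    have "I + e \<le> hr i k" if "i < k" for k
    proof -
      let ?q = "lam * p k + \<mu> k"
      note q = total_rate_pos[OF \<open>i < k\<close>] and m = mu_pos[OF \<open>i < k\<close>]
      have a: "0 \<le> lam * p k" using lam_pos p_bounds(1)[of k] by simp
      \<comment> \<open>The constant 1 of the first-step equation is at least
        \<open>\<mu> k / M\<close>; together with \<open>\<mu> k * (real i / M)\<close> from the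
        state after service it makes up \<open>\<mu> k * B\<close>.\<close>
      have "\<mu> k / M \<le> 1" using mu_upper[of k] M_pos \<open>i < k\<close> by simp
      moreover have "lam * p k * I \<le> lam * p k * hr i (Suc k)"
        using I[of "Suc k"] a \<open>i < k\<close> by (intro mult_left_mono) auto
      moreover have "\<mu> k * (real i / M) \<le> \<mu> k * (if i = 0 then 0 else hr (i - 1) (k - 1))"
        using d[OF \<open>i < k\<close>] m by (intro mult_left_mono) auto
      moreover have "\<mu> k / M + \<mu> k * (real i / M) = \<mu> k * B"
        unfolding B_def by (simp add: add_divide_distrib distrib_left)
      ultimately have "lam * p k * I + \<mu> k * B \<le> ?q * hr i k"
        unfolding hr_first_step[OF \<open>i < k\<close>] by linarith
      then have "\<mu> k * (B - I) \<le> ?q * (hr i k - I)"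
        by (simp add: algebra_simps)
      then have "\<mu> k / ?q * (B - I) \<le> hr i k - I"
        using q by (simp add: field_simps)
      moreover have "e \<le> \<mu> k / ?q * (B - I)"
        unfolding e_def using BI q m mu1_pos mu_lower[of k] total_rate_le[OF \<open>i < k\<close>] \<open>i < k\<close>
        by (intro mult_right_mono frac_le) auto
      ultimately show ?thesis by simp
    qed
    then have "I + e \<le> I"
      by (subst (2) I_def, intro cINF_greatest) auto
    with e show False by simp
  qed
  with I[OF k] show ?thesis by (simp add: B_def)
qed

text \<open>Induction on the number of customers ahead. The total \<open>k\<close> must stay
  arbitrary, since arrivals raise it without bound before the next service.\<close>

lemma hr_ge: "i < k \<Longrightarrow> (real i + 1) / M \<le> hr i k"
proof (induction i arbitrary: k)
  case 0
  then show ?case using hr_ge_step[of 0 k] by simp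
next
  case (Suc i)
  show ?case
  proof (rule hr_ge_step[OF _ Suc.prems])
    fix k assume "Suc i < k"
    then show "real (Suc i) / M \<le> (if Suc i = 0 then 0 else hr (Suc i - 1) (k - 1))"
      using Suc.IH[of "k - 1"] by (simp add: add.commute)
  qed
qed

section \<open>Delay of a joining customer and equilibrium strategies\<close>

lemma delay_eq_hr: "delay lam \<mu> p n = ereal (hr n (n + 1))"
  unfolding delay_def remaining_delay_def h_eq_hr[OF less_add_one]
  by (rule enn2ereal_ennreal) (simp add: hr_def)

lemma delay_bounds:
  "ereal ((real n + 1) / M) \<le> delay lam \<mu> p n" "delay lam \<mu> p n \<le> ereal ((real n + 1) / \<mu> 1)"
proof -
  show "ereal ((real n + 1) / M) \<le> delay lam \<mu> p n"
    unfolding delay_eq_hr using hr_ge[OF less_add_one[of n]] by (simp only: ereal_less_eq)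
  have "ennreal (hr n (n + 1)) \<le> ennreal ((real n + 1) / \<mu> 1)"
    using h_le[OF less_add_one] unfolding h_eq_hr[OF less_add_one] .
  then show "delay lam \<mu> p n \<le> ereal ((real n + 1) / \<mu> 1)"
    unfolding delay_eq_hr using mu1_pos
    by (subst (asm) ennreal_le_iff) (simp_all only: ereal_less_eq, simp)
qed

lemma n_b_finite: "n_b lam \<mu> R C p < \<infinity>"
proof -
  \<comment> \<open>For such \<open>n\<close> the lower bound \<open>(real n + 1) / M\<close> on the
    delay already exceeds \<open>R / C\<close>.\<close>
  obtain n :: nat where n: "R / C * M < real n" using reals_Archimedean2 by blast
  have "R / C < (real n + 1) / M" using n M_pos by (simp add: pos_less_divide_eq)
  then have "ereal (R / C) - delay lam \<mu> p n < 0"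
    using hr_ge[OF less_add_one[of n]] unfolding delay_eq_hr by simp
  then have "n_b lam \<mu> R C p \<le> enat n"
    unfolding n_b_def by (intro Inf_lower) simp
  then show ?thesis by (rule le_less_trans) simp
qed

lemma n_0_le_n_b:
  assumes "0 < C" and "equilibrium lam \<mu> R C p"
  shows "n_0 p \<le> n_b lam \<mu> R C p"
  unfolding n_b_def
proof (rule Inf_greatest)
  fix m assume "m \<in> enat ` {n. ereal (R / C) - delay lam \<mu> p n < 0}"
  then obtain n where n: "m = enat n" "ereal (R / C) - delay lam \<mu> p n < 0" by auto
  let ?w = "hr n (n + 1)"
  \<comment> \<open>The deviation that never joins earns 0, so the equilibrium benefit at
    \<open>n\<close> is nonnegative although its last factor is negative. This forces
    \<open>p n\<close> to vanish.\<close>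
  have "net_benefit lam \<mu> R C n (\<lambda>_. 0) p \<le> net_benefit lam \<mu> R C n p p"
    using assms(2) by (auto simp: equilibrium_def strategies_def)
  then have "0 \<le> C * p n * (R / C - ?w)"
    by (simp add: net_benefit_def delay_eq_hr zero_ereal_def)
  moreover have "R / C - ?w < 0" using n(2) by (simp add: delay_eq_hr)
  ultimately have "C * p n \<le> 0" by (simp add: zero_le_mult_iff)
  then have "p n = 0" using assms(1) p_bounds(1)[of n] by (simp add: mult_le_0_iff)
  then show "n_0 p \<le> m"
    unfolding n_0_def n(1) by (intro Inf_lower) simp
qed

end

theorem lemma1:
  fixes lam M R C :: real and \<mu> :: "nat \<Rightarrow> real"
  assumes "0 < lam"
    and "0 < \<mu> 1"
    and "\<And>n. 1 \<le> n \<Longrightarrow> \<mu> n \<le> \<mu> (n + 1)"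
    and "\<mu> \<longlonglongrightarrow> M"
    and "0 \<le> R" and "0 < C"
  shows "(\<forall>p\<in>strategies.
            (\<forall>n. ereal ((real n + 1) / M) \<le> delay lam \<mu> p n \<and>
                 delay lam \<mu> p n \<le> ereal ((real n + 1) / \<mu> 1)) \<and>
            n_b lam \<mu> R C p < \<infinity>) \<and>
         (\<forall>p. equilibrium lam \<mu> R C p \<longrightarrow>
            n_0 p \<le> n_b lam \<mu> R C p \<and> n_b lam \<mu> R C p < \<infinity>)"
proof -
  have mono: "\<mu> m \<le> \<mu> n" if "1 \<le> m" "m \<le> n" for m n
    using that(2)
  proof (induction rule: dec_induct)
    case (step n)
    then show ?case using assms(3)[of n] that(1) by simp
  qed simp
  \<comment> \<open>From index \<open>n\<close> on, the sequence stays above \<open>\<mu> n\<close>,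
    hence so does its limit.\<close>
  have le_M: "\<mu> n \<le> M" if "1 \<le> n" for n
    using assms(4) by (rule Lim_bounded2[where N = n]) (use mono that in blast)
  have queue: "queue lam M \<mu> p" if "p \<in> strategies" for p
    using that assms(1,2) mono le_M by unfold_locales (auto simp: strategies_def Pi_iff)
  show ?thesis
  proof (intro conjI ballI allI impI)
    fix p assume "equilibrium lam \<mu> R C p"
    then have "p \<in> strategies" by (simp add: equilibrium_def)
    from queue.n_0_le_n_b[OF queue[OF this] \<open>0 < C\<close>] queue.n_b_finite[OF queue[OF this]]
    show "n_0 p \<le> n_b lam \<mu> R C p" "n_b lam \<mu> R C p < \<infinity>"
      using \<open>equilibrium lam \<mu> R C p\<close> by blast+
  qed (use queue.delay_bounds[OF queue] queue.n_b_finite[OF queue] in blast)+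
qed

end
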